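(* Let $V$ be a finite-dimensional real vector space and let $C$ be an open convex cone in $V$. Let $F$ be an analytic function on the tube $C+iV$ that is real and strictly positive on $C$. If $F^{-\beta}$ is completely monotone on $C$ for at least one $\beta>0$, then $F$ is nonvanishing on $C+iV$. [In particular, when $V=\mathbb{R}^n$ and $C=(0,\infty)^n$, the function $F$ has the half-plane property, i.e. $F(x_1,\ldots,x_n)\ne 0$ whenever $x_1,\ldots,x_n$ are complex numbers with strictly positive real part.]
   Context: The tube $C+iV$ is the subset $\{x+iy\colon x\in C,\ y\in V\}$ of the complexification of $V$. A $C^\infty$ function $f\colon C\to\mathbb{R}$ is completely monotone if for all $k\ge 0$, all $\mathbf{u}_1,\ldots,\mathbf{u}_k\in C$ and all $\mathbf{x}\in C$, one has $(-1)^kD_{\mathbf{u}_1}\cdots D_{\mathbf{u}_k}f(\mathbf{x})\ge 0$, where $D_{\mathbf{u}}$ is the directional derivative. *)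

theory Defs
  imports "HOL-Analysis.Analysis"
begin

(* Only multiplication by strictly positive scalars is required: the library predicates
   cone and convex_cone also allow the scalar 0, and an open set closed under
   multiplication by 0 is empty or the whole space. *)
definition open_convex_cone :: "'a::real_normed_vector set \<Rightarrow> bool" where
  "open_convex_cone C \<longleftrightarrow> open C \<and> convex C \<and> (\<forall>x\<in>C. \<forall>c>0. c *\<^sub>R x \<in> C)"

definition dir_deriv :: "'a::real_normed_vector \<Rightarrow> ('a \<Rightarrow> real) \<Rightarrow> 'a \<Rightarrow> real" where
  "dir_deriv u f x = deriv (\<lambda>t. f (x + t *\<^sub>R u)) 0"

(* Used for open S in a finite-dimensional space, where it suffices to control the
   derivative direction by direction. *)
fun C_k_on :: "nat \<Rightarrow> ('a::real_normed_vector \<Rightarrow> real) \<Rightarrow> 'a set \<Rightarrow> bool" where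
  "C_k_on 0 f S \<longleftrightarrow> continuous_on S f"
| "C_k_on (Suc k) f S \<longleftrightarrow>
     (\<forall>x\<in>S. f differentiable (at x)) \<and> (\<forall>v. C_k_on k (dir_deriv v f) S)"

definition C_infinity_on :: "('a::real_normed_vector \<Rightarrow> real) \<Rightarrow> 'a set \<Rightarrow> bool" where
  "C_infinity_on f S \<longleftrightarrow> (\<forall>k. C_k_on k f S)"

(* foldr dir_deriv [u1, ..., uk] f is the iterated derivative D_u1 (... (D_uk f)). *)
definition completely_monotone_on :: "('a::real_normed_vector \<Rightarrow> real) \<Rightarrow> 'a set \<Rightarrow> bool" where
  "completely_monotone_on f C \<longleftrightarrow> C_infinity_on f C \<and>
     (\<forall>us x. set us \<subseteq> C \<longrightarrow> x \<in> C \<longrightarrow> 0 \<le> (-1) ^ length us * foldr dir_deriv us f x)"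

(* The complexification of V is V \<times> V, where (x, y) stands for x + iy. *)
definition complexification_scale ::
    "complex \<Rightarrow> 'a::real_vector \<times> 'a \<Rightarrow> 'a \<times> 'a" where
  "complexification_scale c = (\<lambda>(x, y). (Re c *\<^sub>R x - Im c *\<^sub>R y, Re c *\<^sub>R y + Im c *\<^sub>R x))"

definition tube :: "'a set \<Rightarrow> ('a \<times> 'a) set" where
  "tube C = {(x, y). x \<in> C}"

(* As for the library's analytic_on, analytic means complex differentiable; S is open in
   all uses. The first argument is the complex scalar multiplication of the domain. *)
definition complex_analytic_on ::
    "(complex \<Rightarrow> 'v \<Rightarrow> 'v) \<Rightarrow> ('v::real_normed_vector \<Rightarrow> complex) \<Rightarrow> 'v set \<Rightarrow> bool" where
  "complex_analytic_on scl F S \<longleftrightarrow>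
     (\<forall>z\<in>S. \<exists>D. (F has_derivative D) (at z) \<and> (\<forall>c h. D (scl c h) = c * D h))"

definition positive_orthant :: "(real ^ 'n) set" where
  "positive_orthant = {x. \<forall>i. 0 < x $ i}"

definition right_half_planes :: "(complex ^ 'n) set" where
  "right_half_planes = {z. \<forall>i. 0 < Re (z $ i)}"

definition complex_vec :: "real ^ 'n \<Rightarrow> complex ^ 'n" where
  "complex_vec x = (\<chi> i. complex_of_real (x $ i))"

definition half_plane_property :: "(complex ^ 'n \<Rightarrow> complex) \<Rightarrow> bool" where
  "half_plane_property F \<longleftrightarrow> (\<forall>z\<in>right_half_planes. F z \<noteq> 0)"

end

theory Submission
  imports Defs "HOL-Complex_Analysis.Complex_Analysis"
begin

text \<open>
  The proof avoids the representation of completely monotone functions as Laplace transforms and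
  reduces everything to one complex variable. A function \<open>h\<close> on a disc around \<open>0\<close>, positive on the
  real diameter, such that \<open>h powr (-\<beta>)\<close> has nonnegative Taylor coefficients at \<open>0\<close>, satisfies
  \<open>\<bar>h w\<bar> \<ge> h \<bar>w\<bar>\<close> up to the modulus of its first zero (as in Pringsheim's theorem); by continuity
  there is no such zero.

  Given \<open>x0 + i y0\<close> in the tube, write \<open>y0 = v - u\<close> with \<open>u, v \<in> C\<close> and take
  \<open>h w = F (c - \<rho> w u - \<rho> w^n v)\<close>. Since the curve is a polynomial in \<open>w\<close> whose higher coefficients lie in
  \<open>- C\<close>, complete monotonicity makes the Taylor coefficients nonnegative. With \<open>\<theta> = 2 pi / (n + 1)\<close>
  the point \<open>w = cis \<theta>\<close> satisfies \<open>w^n = cis (-\<theta>)\<close>, so for \<open>\<rho> = 1 / sin \<theta>\<close> the curve reaches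
  \<open>c - \<rho> cos \<theta> (u + v) + i (v - u)\<close>, which is \<open>x0 + i y0\<close> for a suitable \<open>c \<in> C\<close>. The unit disc is mapped
  into the tube as soon as \<open>x0 - tan (\<theta>/2) (u + v) \<in> C\<close>, i.e. for large \<open>n\<close>.
\<close>

section \<open>One complex variable: nonnegative Taylor coefficients and zeros\<close>

lemma higher_deriv_of_real_eq:
  fixes g :: "nat \<Rightarrow> real \<Rightarrow> real"
  assumes hol: "H holomorphic_on ball 0 \<delta>"
    and H: "\<And>x. \<bar>x\<bar> < \<delta> \<Longrightarrow> H (of_real x) = of_real (g 0 x)"
    and g: "\<And>k x. \<bar>x\<bar> < \<delta> \<Longrightarrow> (g k has_real_derivative g (Suc k) x) (at x)"
    and x: "\<bar>x\<bar> < \<delta>"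
  shows "(deriv ^^ k) H (of_real x) = of_real (g k x)"
  using x
proof (induction k arbitrary: x)
  case 0
  then show ?case using H by simp
next
  case (Suc k)
  \<comment> \<open>The derivative along the real axis is found twice: from holomorphy, and from the
    induction hypothesis, which must therefore hold on a whole interval around \<open>x\<close> and
    not just at the point.\<close>
  have "((deriv ^^ k) H has_field_derivative (deriv ^^ Suc k) H (of_real x)) (at (of_real x))"
    using has_field_derivative_higher_deriv[OF hol] Suc.prems by simp
  then have "((\<lambda>t. (deriv ^^ k) H (of_real t)) has_vector_derivative (deriv ^^ Suc k) H (of_real x)) (at x)"
    using has_vector_derivative_real_field by blast
  moreover have "((\<lambda>t. (deriv ^^ k) H (of_real t)) has_vector_derivative of_real (g (Suc k) x)) (at x)"
  proof (rule has_vector_derivative_transform_within_open[where S = "{-\<delta><..<\<delta>}"])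
    show "((\<lambda>t. complex_of_real (g k t)) has_vector_derivative of_real (g (Suc k) x)) (at x)"
      using g[OF Suc.prems] by (rule has_vector_derivative_of_real)
  qed (use Suc in auto)
  ultimately show ?case
    by (rule vector_derivative_unique_at)
qed

text \<open>This is the triangle inequality for the Taylor series at 0. Agreement of
  \<open>H\<close> with \<open>g 0\<close> on a small interval already determines the coefficients
  as \<open>g k 0 / fact k\<close>, while the series converges on the whole disc of radius
  \<open>r\<close>.\<close>

lemma norm_le_norm_of_nonneg_derivs:
  fixes g :: "nat \<Rightarrow> real \<Rightarrow> real"
  assumes hol: "H holomorphic_on ball 0 r" and "0 < \<delta>" "\<delta> \<le> r"
    and H: "\<And>x. \<bar>x\<bar> < \<delta> \<Longrightarrow> H (of_real x) = of_real (g 0 x)"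
    and g: "\<And>k x. \<bar>x\<bar> < \<delta> \<Longrightarrow> (g k has_real_derivative g (Suc k) x) (at x)"
    and nonneg: "\<And>k. 0 \<le> g k 0"
    and w: "norm w < r"
  shows "norm (H w) \<le> norm (H (of_real (norm w)))"
proof -
  define a where "a k = g k 0 / fact k * norm w ^ k" for k
  have D: "(deriv ^^ k) H 0 = of_real (g k 0)" for k
  proof -
    have "H holomorphic_on ball 0 \<delta>"
      using \<open>\<delta> \<le> r\<close> by (intro holomorphic_on_subset[OF hol]) auto
    then show ?thesis
      using higher_deriv_of_real_eq[of H \<delta> g 0 k] H g \<open>0 < \<delta>\<close> by simp
  qed
  have 1: "(\<lambda>k. of_real (g k 0) / fact k * w ^ k) sums H w"
    using holomorphic_power_series[OF hol, of w] w by (simp add: D)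
  have "(\<lambda>k. complex_of_real (a k)) sums H (of_real (norm w))"
    using holomorphic_power_series[OF hol, of "of_real (norm w)"] w by (simp add: D a_def)
  then have s: "a sums Re (H (of_real (norm w)))"
    using sums_Re by fastforce
  have "norm (of_real (g k 0) / fact k * w ^ k) = a k" for k
    using nonneg by (simp add: a_def norm_mult norm_divide norm_power)
  then have "norm (suminf (\<lambda>k. of_real (g k 0) / fact k * w ^ k)) \<le> suminf a"
    using sums_summable[OF s] by (intro norm_suminf_le) auto
  then have "norm (H w) \<le> Re (H (of_real (norm w)))"
    using 1 s by (simp add: sums_iff)
  then show ?thesis using complex_Re_le_cmod order_trans by blast
qed

text \<open>On a disc without zeros, \<open>h\<close> has a holomorphic logarithm and hence a branch
  \<open>H\<close> of its power with exponent \<open>-\<beta>\<close>. The preceding inequality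
  applies to \<open>H\<close>, and the negative exponent reverses it for \<open>h\<close>.\<close>

lemma norm_ge_norm_of_nonneg_derivs:
  fixes h :: "complex \<Rightarrow> complex" and g :: "nat \<Rightarrow> real \<Rightarrow> real"
  assumes hol: "h holomorphic_on ball 0 r" and nz: "\<And>z. norm z < r \<Longrightarrow> h z \<noteq> 0"
    and \<beta>: "0 < \<beta>"
    and pos: "\<And>x. \<bar>x\<bar> < r \<Longrightarrow> h (of_real x) \<in> \<real> \<and> 0 < Re (h (of_real x))"
    and g0: "\<And>x. \<bar>x\<bar> < r \<Longrightarrow> g 0 x = Re (h (of_real x)) powr (- \<beta>)"
    and g: "\<And>k x. \<bar>x\<bar> < r \<Longrightarrow> (g k has_real_derivative g (Suc k) x) (at x)"
    and nonneg: "\<And>k. 0 \<le> g k 0"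
    and w: "norm w < r"
  shows "norm (h (of_real (norm w))) \<le> norm (h w)"
proof -
  have "0 < r" using w norm_ge_zero[of w] by linarith
  obtain L0 where L0: "L0 holomorphic_on ball 0 r" "\<And>z. z \<in> ball 0 r \<Longrightarrow> exp (L0 z) = h z"
    using holomorphic_logarithm_exists[OF convex_ball open_ball hol, of 0] nz \<open>0 < r\<close> by auto
  \<comment> \<open>The branch is normalised to be real at 0. Otherwise \<open>H\<close> could
    differ from the real power by a constant factor of modulus 1.\<close>
  define L where "L z = L0 z - L0 0 + Ln (h 0)" for z
  have Lhol: "L holomorphic_on ball 0 r"
    unfolding L_def using L0(1) by (intro holomorphic_intros)
  have expL: "exp (L z) = h z" if "norm z < r" for z
    using L0(2)[of z] L0(2)[of 0] that \<open>0 < r\<close> nz[of 0]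
    by (simp add: L_def exp_add exp_diff exp_Ln)
  have ImL0: "Im (L 0) = 0"
  proof -
    have "h 0 = of_real (Re (h 0))"
      using pos[of 0] \<open>0 < r\<close> by (simp add: complex_is_Real_iff complex_eq_iff)
    then show ?thesis
      using pos[of 0] \<open>0 < r\<close> Ln_of_real[of "Re (h 0)"] by (simp add: L_def)
  qed
  \<comment> \<open>Close to 0 the imaginary part of \<open>L\<close> stays in (-pi, pi), so there
    \<open>L\<close> is the principal logarithm of \<open>h\<close> and \<open>H\<close> is the real
    power on the real axis. A small interval suffices, because only the derivatives at 0
    matter.\<close>
  have "isCont L 0"
    using holomorphic_on_imp_continuous_on[OF Lhol] \<open>0 < r\<close>
    by (simp add: continuous_on_eq_continuous_at)
  then have "isCont (\<lambda>z. Im (L z)) 0"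
    by (rule isCont_Im)
  then obtain d where d: "d > 0" "\<And>z. norm z < d \<Longrightarrow> \<bar>Im (L z)\<bar> < pi"
    using ImL0 unfolding continuous_at_eps_delta
    by (auto simp: dist_norm dest!: spec[of _ pi])
  define \<delta> where "\<delta> = min d r"
  have \<delta>: "0 < \<delta>" "\<delta> \<le> r" using d(1) \<open>0 < r\<close> by (auto simp: \<delta>_def)
  define H where "H z = exp (of_real (- \<beta>) * L z)" for z
  have normH: "norm (H z) = norm (h z) powr (- \<beta>)" if "norm z < r" for z
    using nz[OF that] expL[OF that, symmetric] by (simp add: H_def powr_def)
  have "norm (H w) \<le> norm (H (of_real (norm w)))"
  proof (rule norm_le_norm_of_nonneg_derivs[OF _ \<delta>, of H g])
    show "H holomorphic_on ball 0 r"
      unfolding H_def using Lhol by (intro holomorphic_intros)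
    fix x :: real assume x: "\<bar>x\<bar> < \<delta>"
    define y where "y = Re (h (of_real x))"
    have y: "0 < y" "h (of_real x) = of_real y"
      using pos[of x] x \<delta> by (auto simp: y_def complex_is_Real_iff complex_eq_iff)
    have "\<bar>Im (L (of_real x))\<bar> < pi"
      using d(2)[of "of_real x"] x by (simp add: \<delta>_def)
    then have "L (of_real x) = Ln (exp (L (of_real x)))"
      by (intro Ln_exp[symmetric]) auto
    also have "\<dots> = of_real (ln y)"
      using expL[of "of_real x"] x \<delta> y by (simp add: Ln_of_real)
    finally have "H (of_real x) = of_real (exp (- \<beta> * ln y))"
      by (simp add: H_def flip: exp_of_real)
    then show "H (of_real x) = of_real (g 0 x)"
      using g0[of x] x \<delta> y by (simp add: powr_def)
  qed (use g nonneg w \<delta> in auto)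
  then have "norm (h w) powr (- \<beta>) \<le> norm (h (of_real (norm w))) powr (- \<beta>)"
    using normH w by simp
  then show ?thesis
    using nz[OF w] \<beta> powr_less_mono2_neg[of "- \<beta>" "norm (h w)" "norm (h (of_real (norm w)))"]
    by (simp only: not_less[symmetric] zero_less_norm_iff neg_less_0_iff_less) blast
qed

text \<open>Let \<open>w\<close> be a zero of least modulus \<open>r\<close>. The preceding
  inequality holds at \<open>t * w\<close> for 0 < t < 1; as t tends to 1 it bounds the modulus of
  \<open>h\<close> at the real point \<open>r\<close> by that of \<open>h w\<close>, which is 0,
  against positivity.\<close>

lemma nonzero_of_nonneg_derivs:
  fixes h :: "complex \<Rightarrow> complex" and g :: "nat \<Rightarrow> real \<Rightarrow> real"
  assumes hol: "h holomorphic_on ball 0 R"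
    and \<beta>: "0 < \<beta>"
    and pos: "\<And>x. \<bar>x\<bar> < R \<Longrightarrow> h (of_real x) \<in> \<real> \<and> 0 < Re (h (of_real x))"
    and g0: "\<And>x. \<bar>x\<bar> < R \<Longrightarrow> g 0 x = Re (h (of_real x)) powr (- \<beta>)"
    and g: "\<And>k x. \<bar>x\<bar> < R \<Longrightarrow> (g k has_real_derivative g (Suc k) x) (at x)"
    and nonneg: "\<And>k. 0 \<le> g k 0"
    and z: "norm z < R"
  shows "h z \<noteq> 0"
proof
  assume "h z = 0"
  have cont: "continuous_on (ball 0 R) h"
    using hol by (rule holomorphic_on_imp_continuous_on)
  define Z where "Z = {w \<in> cball 0 (norm z). h w = 0}"
  have "continuous_on (cball 0 (norm z)) h"
    using z by (intro continuous_on_subset[OF cont]) auto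
  then have "closed Z"
    unfolding Z_def by (intro continuous_closed_preimage_constant) auto
  moreover have "Z \<subseteq> cball 0 (norm z)"
    by (auto simp: Z_def)
  ultimately have "compact Z"
    using bounded_cball bounded_subset compact_eq_bounded_closed by blast
  moreover have "z \<in> Z" using \<open>h z = 0\<close> by (simp add: Z_def)
  ultimately obtain w where w: "w \<in> Z" "\<And>v. v \<in> Z \<Longrightarrow> norm w \<le> norm v"
    using continuous_attains_inf[of Z norm] continuous_on_norm_id by blast
  define r where "r = norm w"
  have r: "r < R" "r \<le> norm z" and hw: "h w = 0" using w(1) z by (auto simp: Z_def r_def)
  have nz: "h v \<noteq> 0" if "norm v < r" for v
    using w(2)[of v] that r by (force simp: Z_def r_def)
  have le: "norm (h (of_real (t * r))) \<le> norm (h (of_real t * w))" if t: "0 < t" "t < 1" for t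
  proof -
    \<comment> \<open>A zero of modulus 0 would be the origin, where \<open>h\<close> is
      positive.\<close>
    have "r > 0" using pos[of 0] hw r by (auto simp: r_def)
    then have "norm (of_real t * w) < r" using t by (simp add: norm_mult flip: r_def)
    then have "norm (h (of_real (norm (of_real t * w)))) \<le> norm (h (of_real t * w))"
      by (rule norm_ge_norm_of_nonneg_derivs[of h r \<beta> g, rotated -1])
        (use r nz \<beta> pos g0 g nonneg holomorphic_on_subset[OF hol subset_ball] in auto)
    then show ?thesis using t by (simp add: norm_mult flip: r_def)
  qed
  have lim: "((\<lambda>t::real. h (of_real t * v)) \<longlongrightarrow> h v) (at_left 1)" if "norm v = r" for v
  proof -
    have "isCont h v" using cont that r by (simp add: continuous_on_eq_continuous_at)
    moreover have "((\<lambda>t::real. of_real t * v) \<longlongrightarrow> of_real 1 * v) (at_left 1)"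
      by (intro tendsto_intros)
    ultimately show ?thesis by (auto intro: isCont_tendsto_compose)
  qed
  have "0 \<le> r" by (simp add: r_def)
  have "norm (h (of_real r)) \<le> norm (h w)"
  proof (rule tendsto_le[OF trivial_limit_at_left_real])
    show "((\<lambda>t. norm (h (of_real t * w))) \<longlongrightarrow> norm (h w)) (at_left (1::real))"
      by (intro tendsto_norm lim) (simp add: r_def)
    show "((\<lambda>t. norm (h (of_real t * of_real r))) \<longlongrightarrow> norm (h (of_real r))) (at_left (1::real))"
      using \<open>0 \<le> r\<close> by (intro tendsto_norm lim) simp
    show "eventually (\<lambda>t. norm (h (of_real t * of_real r)) \<le> norm (h (of_real t * w))) (at_left (1::real))"
      using eventually_at_left_real[OF zero_less_one] by eventually_elim (use le in auto)
  qed
  then show False using pos[of r] hw r \<open>0 \<le> r\<close> by auto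
qed

section \<open>Completely monotone functions along polynomial curves\<close>

lemma C_infinity_on_dir_deriv: "C_infinity_on f S \<Longrightarrow> C_infinity_on (dir_deriv v f) S"
  unfolding C_infinity_on_def using C_k_on.simps(2) by blast

lemma C_infinity_on_foldr_dir_deriv: "C_infinity_on f S \<Longrightarrow> C_infinity_on (foldr dir_deriv us f) S"
  by (induction us) (auto intro: C_infinity_on_dir_deriv)

text \<open>\<open>dir_deriv\<close> rests on \<open>deriv\<close>, a choice operator that means
  nothing without differentiability. Here it is identified with the total derivative, which makes it
  linear in the direction, as the chain rule along a curve requires.\<close>

lemma C_infinity_on_has_derivative:
  assumes "C_infinity_on f S" "x \<in> S"
  shows "(f has_derivative (\<lambda>v. dir_deriv v f x)) (at x)"
proof -
  have "f differentiable (at x)"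
    using assms C_k_on.simps(2)[of 0 f S] unfolding C_infinity_on_def by blast
  then obtain D where D: "(f has_derivative D) (at x)"
    unfolding differentiable_def by blast
  have "dir_deriv v f x = D v" for v
  proof -
    have "((\<lambda>t. x + t *\<^sub>R v) has_derivative (\<lambda>t. t *\<^sub>R v)) (at 0)"
      by (auto intro!: derivative_eq_intros)
    moreover have "(f has_derivative D) (at (x + 0 *\<^sub>R v))" using D by simp
    ultimately have "((\<lambda>t. f (x + t *\<^sub>R v)) has_derivative (\<lambda>t. D (t *\<^sub>R v))) (at 0)"
      by (rule has_derivative_compose)
    moreover have "(\<lambda>t. D (t *\<^sub>R v)) = (*) (D v)"
      using has_derivative_linear[OF D] by (auto simp: linear_cmul)
    ultimately have "((\<lambda>t. f (x + t *\<^sub>R v)) has_field_derivative D v) (at 0)"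
      by (simp add: has_field_derivative_def)
    then show ?thesis unfolding dir_deriv_def by (rule DERIV_imp_deriv)
  qed
  then show ?thesis using D by presburger
qed

text \<open>A class of functions that is closed under differentiation along the curves below and
  nonnegative at 0. It replaces an explicit formula for the higher derivatives of a composition. The
  powers of \<open>x\<close> come from differentiating \<open>x ^ n\<close> in the curve.\<close>

inductive derivative_combination :: "'a::real_normed_vector set \<Rightarrow> ('a \<Rightarrow> real) \<Rightarrow> (real \<Rightarrow> 'a) \<Rightarrow> (real \<Rightarrow> real) \<Rightarrow> bool"
  for C f \<gamma> where
  monomial: "0 \<le> a \<Longrightarrow> set us \<subseteq> C \<Longrightarrow>
    derivative_combination C f \<gamma> (\<lambda>x. a * x ^ j * ((-1) ^ length us * foldr dir_deriv us f (\<gamma> x)))"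
| add: "derivative_combination C f \<gamma> g1 \<Longrightarrow> derivative_combination C f \<gamma> g2 \<Longrightarrow> derivative_combination C f \<gamma> (\<lambda>x. g1 x + g2 x)"

lemma derivative_combination_nonneg:
  assumes "derivative_combination C f \<gamma> g" "completely_monotone_on f C" "0 \<le> x" "\<gamma> x \<in> C"
  shows "0 \<le> g x"
  using assms
proof (induction rule: derivative_combination.induct)
  case (monomial a us j)
  then have "0 \<le> (-1) ^ length us * foldr dir_deriv us f (\<gamma> x)"
    unfolding completely_monotone_on_def by blast
  then show ?case
    using monomial by (intro mult_nonneg_nonneg[of "a * x ^ j"] mult_nonneg_nonneg[of a]) auto
qed auto

text \<open>Both terms of the velocity of \<open>\<gamma>\<close> are nonpositive multiples of
  \<open>u\<close> or \<open>v\<close> when \<open>x\<close> is nonnegative. Each differentiation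
  puts \<open>u\<close> or \<open>v\<close> in front of \<open>us\<close>, and the minus sign
  supplies the extra factor -1 demanded by the longer list.\<close>

lemma derivative_combination_deriv:
  fixes u v c :: "'a::real_normed_vector" and \<rho> :: real and n :: nat
  defines "\<gamma> \<equiv> \<lambda>x. c - (\<rho> * x) *\<^sub>R u - (\<rho> * x ^ n) *\<^sub>R v"
  assumes "derivative_combination C f \<gamma> g" and f: "completely_monotone_on f C"
    and "u \<in> C" "v \<in> C" "0 \<le> \<rho>"
  shows "\<exists>g'. derivative_combination C f \<gamma> g' \<and> (\<forall>x. \<gamma> x \<in> C \<longrightarrow> (g has_real_derivative g' x) (at x))"
  using assms(2)
proof (induction rule: derivative_combination.induct)
  case (monomial a us j)
  define \<phi> where "\<phi> us x = (-1) ^ length us * foldr dir_deriv us f (\<gamma> x)" for us x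
  \<comment> \<open>Product rule, with one term for each of the directions \<open>u\<close> and
    \<open>v\<close>. Truncated subtraction is harmless: for \<open>j = 0\<close> or
    \<open>n = 0\<close> the coefficient in front vanishes.\<close>
  define g' where "g' x = (a * j) * x ^ (j - 1) * \<phi> us x
      + ((a * \<rho>) * x ^ j * \<phi> (u # us) x + (a * \<rho> * n) * x ^ (j + (n - 1)) * \<phi> (v # us) x)" for x
  have "derivative_combination C f \<gamma> g'"
    unfolding g'_def \<phi>_def
    by (intro derivative_combination.intros) (use monomial assms in auto)
  moreover have "((\<lambda>x. a * x ^ j * \<phi> us x) has_real_derivative g' x) (at x)" if x: "\<gamma> x \<in> C" for x
  proof -
    let ?f = "foldr dir_deriv us f"
    \<comment> \<open>The velocity of \<open>\<gamma>\<close> at \<open>x\<close>.\<close>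
    let ?d = "- \<rho> *\<^sub>R u - (\<rho> * (n * x ^ (n - 1))) *\<^sub>R v"
    have df: "(?f has_derivative (\<lambda>v. dir_deriv v ?f (\<gamma> x))) (at (\<gamma> x))"
      using f x unfolding completely_monotone_on_def
      by (intro C_infinity_on_has_derivative C_infinity_on_foldr_dir_deriv) auto
    note lin = has_derivative_linear[OF df]
    have "(\<gamma> has_derivative (\<lambda>t. t *\<^sub>R ?d)) (at x)"
      unfolding \<gamma>_def by (auto intro!: derivative_eq_intros simp: algebra_simps)
    from has_derivative_compose[OF this df]
    have "((\<lambda>x. ?f (\<gamma> x)) has_derivative (\<lambda>t. dir_deriv (t *\<^sub>R ?d) ?f (\<gamma> x))) (at x)" .
    moreover have "(\<lambda>t. dir_deriv (t *\<^sub>R ?d) ?f (\<gamma> x))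
        = (*) (- \<rho> * dir_deriv u ?f (\<gamma> x) - \<rho> * (n * x ^ (n - 1)) * dir_deriv v ?f (\<gamma> x))"
      by (rule ext, unfold linear_cmul[OF lin] linear_diff[OF lin])
        (simp only: linear_cmul[OF lin] real_scaleR_def mult_ac)
    ultimately have "((\<lambda>x. ?f (\<gamma> x)) has_real_derivative
        (- \<rho> * dir_deriv u ?f (\<gamma> x) - \<rho> * (n * x ^ (n - 1)) * dir_deriv v ?f (\<gamma> x))) (at x)"
      by (simp add: has_field_derivative_def)
    then show ?thesis
      unfolding \<phi>_def g'_def
      by (auto intro!: derivative_eq_intros simp: algebra_simps power_add)
  qed
  ultimately show ?case unfolding \<phi>_def by blast
next
  case (add g1 g2)
  then obtain g1' g2' where
    "derivative_combination C f \<gamma> g1'" "\<forall>x. \<gamma> x \<in> C \<longrightarrow> (g1 has_real_derivative g1' x) (at x)"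
    "derivative_combination C f \<gamma> g2'" "\<forall>x. \<gamma> x \<in> C \<longrightarrow> (g2 has_real_derivative g2' x) (at x)" by blast
  then show ?case
    by (intro exI[of _ "\<lambda>x. g1' x + g2' x"]) (auto intro: derivative_combination.add DERIV_add)
qed

text \<open>Iterating the preceding lemma yields all derivatives along the curve; at
  \<open>x = 0\<close> they are nonnegative, which is the input of
  \<open>nonzero_of_nonneg_derivs\<close>.\<close>

lemma completely_monotone_on_curve:
  fixes u v c :: "'a::real_normed_vector" and \<rho> :: real and n :: nat
  defines "\<gamma> \<equiv> \<lambda>x. c - (\<rho> * x) *\<^sub>R u - (\<rho> * x ^ n) *\<^sub>R v"
  assumes f: "completely_monotone_on f C" and "u \<in> C" "v \<in> C" "0 \<le> \<rho>" "\<gamma> 0 \<in> C"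
  obtains g :: "nat \<Rightarrow> real \<Rightarrow> real" where "g 0 = (\<lambda>x. f (\<gamma> x))"
    "\<And>k x. \<gamma> x \<in> C \<Longrightarrow> (g k has_real_derivative g (Suc k) x) (at x)" "\<And>k. 0 \<le> g k 0"
proof -
  have base: "derivative_combination C f \<gamma> (\<lambda>x. f (\<gamma> x))"
    using derivative_combination.monomial[of 1 "[]" C f \<gamma> 0] by simp
  \<comment> \<open>The clause for \<open>k = 0\<close> pins the start of the sequence produced by
    dependent choice.\<close>
  have "\<exists>g. \<forall>k. (derivative_combination C f \<gamma> (g k) \<and> (k = 0 \<longrightarrow> g k = (\<lambda>x. f (\<gamma> x)))) \<and>
      (\<forall>x. \<gamma> x \<in> C \<longrightarrow> (g k has_real_derivative g (Suc k) x) (at x))"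
  proof (rule dependent_nat_choice)
    fix g k assume "derivative_combination C f \<gamma> g \<and> (k = (0::nat) \<longrightarrow> g = (\<lambda>x. f (\<gamma> x)))"
    then show "\<exists>g'. (derivative_combination C f \<gamma> g' \<and> (Suc k = 0 \<longrightarrow> g' = (\<lambda>x. f (\<gamma> x)))) \<and>
        (\<forall>x. \<gamma> x \<in> C \<longrightarrow> (g has_real_derivative g' x) (at x))"
      using derivative_combination_deriv[of C f c \<rho> u n v g, folded \<gamma>_def] assms by simp
  qed (use base in auto)
  then obtain g where g: "\<And>k. derivative_combination C f \<gamma> (g k)" "g 0 = (\<lambda>x. f (\<gamma> x))"
    "\<And>k x. \<gamma> x \<in> C \<Longrightarrow> (g k has_real_derivative g (Suc k) x) (at x)" by blast
  show thesis
    by (rule that[OF g(2,3)]) (use derivative_combination_nonneg[OF g(1) f] assms in auto)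
qed

section \<open>Nonvanishing on the tube: room in the cone and the curve through a given
  point\<close>

lemma open_diff_scaleR_mem:
  fixes x y :: "'a::real_normed_vector"
  assumes "open S" "x \<in> S"
  obtains t where "t > 0" "x - t *\<^sub>R y \<in> S"
proof -
  have "((\<lambda>t. x - t *\<^sub>R y) \<longlongrightarrow> x - 0 *\<^sub>R y) (at_right (0::real))"
    by (intro tendsto_intros)
  then have "eventually (\<lambda>t. x - t *\<^sub>R y \<in> S) (at_right (0::real))"
    by (rule topological_tendstoD) (use assms in auto)
  then have "eventually (\<lambda>t. x - t *\<^sub>R y \<in> S \<and> t > 0) (at_right (0::real))"
    using eventually_at_right_less by (rule eventually_conj)
  then show thesis
    using that eventually_happens'[OF trivial_limit_at_right_real] by blast
qed

lemma open_convex_cone_add: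
  assumes "open_convex_cone C" "x \<in> C" "y \<in> C"
  shows "x + y \<in> C"
proof -
  have "(1/2) *\<^sub>R x + (1/2) *\<^sub>R y \<in> C"
    using assms unfolding open_convex_cone_def by (intro convexD) auto
  then have "2 *\<^sub>R ((1/2) *\<^sub>R x + (1/2) *\<^sub>R y) \<in> C"
    using assms unfolding open_convex_cone_def by (metis zero_less_numeral)
  then show ?thesis by (simp add: scaleR_add_right)
qed

text \<open>The quotient is \<open>tan (\<theta>/2)\<close> for \<open>\<theta> = 2 pi / (n + 1)\<close>.\<close>

lemma small_tan_half_angle:
  fixes \<eta> :: real
  assumes "\<eta> > 0"
  obtains n :: nat where "n \<ge> 2" "(1 - cos (2 * pi / Suc n)) / sin (2 * pi / Suc n) < \<eta>"
proof -
  have "(\<lambda>n. pi / real (Suc n)) \<longlonglongrightarrow> 0"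
    using LIMSEQ_Suc[OF lim_const_over_n[of pi]] .
  then have "(\<lambda>n. tan (pi / real (Suc n))) \<longlonglongrightarrow> tan 0"
    using isCont_tendsto_compose[OF isCont_tan, of 0] by fastforce
  then have "eventually (\<lambda>n. tan (pi / real (Suc n)) < \<eta>) sequentially"
    using assms by (intro order_tendstoD) auto
  then obtain n where n: "n \<ge> 2" "tan (pi / real (Suc n)) < \<eta>"
    using eventually_conj[OF _ eventually_ge_at_top[of 2]] eventually_happens'[OF sequentially_bot]
    by (metis (mono_tags, lifting))
  define \<phi> where "\<phi> = pi / real (Suc n)"
  have "0 < \<phi>" "\<phi> < pi" using n(1) by (auto simp: \<phi>_def field_simps)
  then have "sin \<phi> > 0" by (rule sin_gt_zero)
  then have "(1 - cos (2 * \<phi>)) / sin (2 * \<phi>) = tan \<phi>"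
    by (simp add: cos_double_sin sin_double tan_def power2_eq_square)
  then show thesis using that[OF n(1)] n(2) by (simp add: \<phi>_def)
qed

text \<open>\<open>P w\<close> encodes c - \<rho> w u - \<rho> w^n v by its real and imaginary
  parts. Its derivative is complex scaling of a fixed vector \<open>P'\<close>, and \<open>D\<close>
  commutes with complex scaling, so the composition has complex derivative
  \<open>D P'\<close>.\<close>

lemma field_differentiable_complex_curve:
  fixes u v c :: "'a::real_normed_vector" and \<rho> :: real and n :: nat
  defines "P \<equiv> \<lambda>w. (c - (\<rho> * Re w) *\<^sub>R u - (\<rho> * Re (w ^ n)) *\<^sub>R v,
                   - (\<rho> * Im w) *\<^sub>R u - (\<rho> * Im (w ^ n)) *\<^sub>R v)"
  assumes F: "complex_analytic_on complexification_scale F S" and w: "P w \<in> S"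
  shows "(\<lambda>w. F (P w)) field_differentiable (at w)"
proof -
  obtain D where D: "(F has_derivative D) (at (P w))"
    and lin: "\<And>a h. D (complexification_scale a h) = a * D h"
    using F w unfolding complex_analytic_on_def by blast
  define k where "k = of_nat n * w ^ (n - 1)"
  \<comment> \<open>The vector - \<rho> u - \<rho> k v with \<open>k\<close> the derivative of
    \<open>w ^ n\<close>, split into real and imaginary parts.\<close>
  define P' where "P' = (- \<rho> *\<^sub>R u - (\<rho> * Re k) *\<^sub>R v, - (\<rho> * Im k) *\<^sub>R v)"
  have "(P has_derivative (\<lambda>h. (- (\<rho> * Re h) *\<^sub>R u - (\<rho> * Re (k * h)) *\<^sub>R v,
      - (\<rho> * Im h) *\<^sub>R u - (\<rho> * Im (k * h)) *\<^sub>R v))) (at w)"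
    unfolding P_def by (auto intro!: derivative_eq_intros simp: k_def mult_ac simp del: times_complex.sel)
  moreover have "(\<lambda>h. (- (\<rho> * Re h) *\<^sub>R u - (\<rho> * Re (k * h)) *\<^sub>R v,
      - (\<rho> * Im h) *\<^sub>R u - (\<rho> * Im (k * h)) *\<^sub>R v)) = (\<lambda>h. complexification_scale h P')"
    by (auto simp: complexification_scale_def P'_def algebra_simps)
  ultimately have "(P has_derivative (\<lambda>h. complexification_scale h P')) (at w)"
    by simp
  from has_derivative_compose[OF this D]
  have "((\<lambda>w. F (P w)) has_derivative (\<lambda>h. D (complexification_scale h P'))) (at w)" .
  then have "((\<lambda>w. F (P w)) has_field_derivative D P') (at w)"
    by (simp add: lin has_field_derivative_def mult.commute[of _ "D P'"])
  then show ?thesis unfolding field_differentiable_def by blast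
qed

lemma nonzero_on_tube:
  fixes C :: "'a::real_normed_vector set"
  assumes C: "open_convex_cone C"
    and F: "complex_analytic_on complexification_scale F (tube C)"
    and pos: "\<And>x. x \<in> C \<Longrightarrow> F (x, 0) \<in> \<real> \<and> 0 < Re (F (x, 0))"
    and \<beta>: "\<beta> > 0" and cm: "completely_monotone_on (\<lambda>x. Re (F (x, 0)) powr (- \<beta>)) C"
    and x0: "x0 \<in> C"
  shows "F (x0, y0) \<noteq> 0"
proof -
  have C_open: "open C" and scale: "\<And>a x. a > 0 \<Longrightarrow> x \<in> C \<Longrightarrow> a *\<^sub>R x \<in> C"
    using C by (auto simp: open_convex_cone_def)
  \<comment> \<open>Openness puts \<open>x0 - t *\<^sub>R y0\<close> in \<open>C\<close> for some t
    > 0; rescaling it and \<open>x0\<close> writes \<open>y0\<close> as a difference of two elements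
    of \<open>C\<close>.\<close>
  obtain t where t: "t > 0" "x0 - t *\<^sub>R y0 \<in> C"
    using open_diff_scaleR_mem[OF C_open x0] .
  define u where "u = (1 / t) *\<^sub>R (x0 - t *\<^sub>R y0)"
  define v where "v = (1 / t) *\<^sub>R x0"
  have uv: "u \<in> C" "v \<in> C" using scale t x0 by (auto simp: u_def v_def)
  have vu: "v - u = y0" using t(1) by (simp add: u_def v_def algebra_simps)
  obtain \<eta> where \<eta>: "\<eta> > 0" "x0 - \<eta> *\<^sub>R (u + v) \<in> C"
    using open_diff_scaleR_mem[OF C_open x0] .
  \<comment> \<open>Start from the corner \<open>x0 - \<eta> *\<^sub>R (u + v)\<close> and add
    positive multiples of \<open>u\<close> and \<open>v\<close>, which cannot leave the
    cone.\<close>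
  have room: "x0 + a *\<^sub>R u + b *\<^sub>R v \<in> C" if "a > - \<eta>" "b > - \<eta>" for a b
  proof -
    have "(x0 - \<eta> *\<^sub>R (u + v)) + (a + \<eta>) *\<^sub>R u + (b + \<eta>) *\<^sub>R v \<in> C"
      using that \<eta> uv by (intro open_convex_cone_add[OF C] scale) auto
    then show ?thesis by (simp add: algebra_simps)
  qed
  obtain n :: nat where n: "n \<ge> 2" "(1 - cos (2 * pi / Suc n)) / sin (2 * pi / Suc n) < \<eta>"
    using small_tan_half_angle[OF \<eta>(1)] .
  define \<theta> where "\<theta> = 2 * pi / Suc n"
  \<comment> \<open>\<open>n \<ge> 2\<close> keeps the angle strictly below pi, so that its sine is
    positive.\<close>
  have \<theta>: "0 < \<theta>" "\<theta> < pi" using n(1) by (auto simp: \<theta>_def field_simps)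
  then have sin_pos: "sin \<theta> > 0" by (rule sin_gt_zero)
  define \<rho> where "\<rho> = 1 / sin \<theta>"
  \<comment> \<open>The last inequality is the choice of \<open>n\<close>:
    \<open>\<rho> * (1 - cos \<theta>)\<close> is the quotient bounded by
    \<open>\<eta>\<close>.\<close>
  have \<rho>: "\<rho> > 0" "\<rho> * sin \<theta> = 1" "\<rho> < \<rho> * cos \<theta> + \<eta>"
    using sin_pos n(2) unfolding \<rho>_def \<theta>_def[symmetric] by (auto simp: diff_divide_distrib)
  \<comment> \<open>The target \<open>cis \<theta>\<close> has modulus 1, so an open disc of radius
    R > 1 is needed. The inequality at R = 1 is strict and survives a slight enlargement.\<close>
  have "((\<lambda>R. \<rho> * R ^ n) \<longlongrightarrow> \<rho> * 1 ^ n) (at_right (1::real))"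
    by (intro tendsto_intros)
  then have "eventually (\<lambda>R. \<rho> * R ^ n < \<rho> * cos \<theta> + \<eta>) (at_right (1::real))"
    using \<rho> by (intro order_tendstoD) auto
  then have "eventually (\<lambda>R. \<rho> * R ^ n < \<rho> * cos \<theta> + \<eta> \<and> R > 1) (at_right (1::real))"
    using eventually_at_right_less by (rule eventually_conj)
  then obtain R :: real where R: "\<rho> * R ^ n < \<rho> * cos \<theta> + \<eta>" "R > 1"
    using eventually_happens'[OF trivial_limit_at_right_real] by blast
  \<comment> \<open>Chosen to cancel the cosine terms, so that the real part of the curve at
    \<open>cis \<theta>\<close> is \<open>x0\<close>.\<close>
  define c where "c = x0 + (\<rho> * cos \<theta>) *\<^sub>R (u + v)"
  define P where "P = (\<lambda>w. (c - (\<rho> * Re w) *\<^sub>R u - (\<rho> * Re (w ^ n)) *\<^sub>R v,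
                   - (\<rho> * Im w) *\<^sub>R u - (\<rho> * Im (w ^ n)) *\<^sub>R v))"
  define \<gamma> where "\<gamma> x = c - (\<rho> * x) *\<^sub>R u - (\<rho> * x ^ n) *\<^sub>R v" for x
  have P_real: "P (of_real x) = (\<gamma> x, 0)" for x
    by (simp add: P_def \<gamma>_def flip: of_real_power)
  have inC: "fst (P w) \<in> C" if w: "norm w < R" for w
  proof -
    \<comment> \<open>Used with s = Re w and s = Re (w^n), the coefficients by which the curve
      departs from \<open>x0\<close>; \<open>R ^ n\<close> bounds both since R > 1.\<close>
    have *: "\<rho> * cos \<theta> - \<rho> * s > - \<eta>" if "s \<le> R ^ n" for s
    proof -
      have "\<rho> * s \<le> \<rho> * R ^ n" using that \<rho> by (intro mult_left_mono) auto
      then show ?thesis using R(1) by linarith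
    qed
    have "R ^ 1 \<le> R ^ n" using R(2) n(1) by (intro power_increasing) auto
    then have "Re w \<le> R ^ n" using w complex_Re_le_cmod[of w] by simp
    moreover have "Re (w ^ n) \<le> R ^ n"
      using complex_Re_le_cmod[of "w ^ n"] power_mono[of "norm w" R n] w by (simp add: norm_power)
    ultimately have "x0 + (\<rho> * cos \<theta> - \<rho> * Re w) *\<^sub>R u + (\<rho> * cos \<theta> - \<rho> * Re (w ^ n)) *\<^sub>R v \<in> C"
      by (intro room *)
    then show ?thesis by (simp add: P_def c_def algebra_simps)
  qed
  have \<gamma>C: "\<gamma> x \<in> C" if "\<bar>x\<bar> < R" for x
    using inC[of "of_real x"] that by (simp add: P_real)
  obtain g where g: "g 0 = (\<lambda>x. Re (F (\<gamma> x, 0)) powr (- \<beta>))"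
    "\<And>k x. \<gamma> x \<in> C \<Longrightarrow> (g k has_real_derivative g (Suc k) x) (at x)" "\<And>k. 0 \<le> g k 0"
    using completely_monotone_on_curve[OF cm uv, of \<rho> c n, folded \<gamma>_def] \<rho>(1) \<gamma>C[of 0] R(2)
    by auto
  have "F (P (cis \<theta>)) \<noteq> 0"
  proof (rule nonzero_of_nonneg_derivs[where h = "\<lambda>w. F (P w)" and R = R and \<beta> = \<beta> and g = g])
    have "(\<lambda>w. F (P w)) field_differentiable (at w)" if "norm w < R" for w
      using field_differentiable_complex_curve[OF F, of c \<rho> w u n v, folded P_def] inC[OF that]
      by (auto simp: tube_def P_def)
    then show "(\<lambda>w. F (P w)) holomorphic_on ball 0 R"
      by (auto simp: holomorphic_on_def intro: field_differentiable_at_within)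
  qed (use \<beta> g \<gamma>C pos R(2) in \<open>auto simp: P_real\<close>)
  moreover have "P (cis \<theta>) = (x0, y0)"
  proof -
    have "n * \<theta> = 2 * pi - \<theta>" by (simp add: \<theta>_def field_simps)
    then have "cis \<theta> ^ n = cis (2 * pi - \<theta>)" by (simp only: Complex.DeMoivre)
    then show ?thesis
      using \<rho>(2) vu by (simp add: P_def c_def algebra_simps sin_diff cos_diff)
  qed
  ultimately show ?thesis by simp
qed

section \<open>The theorem, with the orthant case transferred to complex vectors\<close>

theorem corollary2p3:
  fixes C :: "'a::real_normed_vector set"
    and F :: "'a \<times> 'a \<Rightarrow> complex"
    and G :: "complex ^ 'n \<Rightarrow> complex"
  shows
    "((\<exists>B::'a set. finite B \<and> span B = UNIV) \<and>
      open_convex_cone C \<and>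
      complex_analytic_on complexification_scale F (tube C) \<and>
      (\<forall>x\<in>C. F (x, 0) \<in> \<real> \<and> 0 < Re (F (x, 0))) \<and>
      (\<exists>\<beta>>0. completely_monotone_on (\<lambda>x. Re (F (x, 0)) powr (- \<beta>)) C)
      \<longrightarrow> (\<forall>z\<in>tube C. F z \<noteq> 0))
   \<and> (complex_analytic_on (*s) G right_half_planes \<and>
      (\<forall>x\<in>positive_orthant. G (complex_vec x) \<in> \<real> \<and> 0 < Re (G (complex_vec x))) \<and>
      (\<exists>\<beta>>0. completely_monotone_on (\<lambda>x. Re (G (complex_vec x)) powr (- \<beta>)) positive_orthant)
      \<longrightarrow> half_plane_property G)"
proof (intro conjI impI)
  assume "(\<exists>B::'a set. finite B \<and> span B = UNIV) \<and>
      open_convex_cone C \<and>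
      complex_analytic_on complexification_scale F (tube C) \<and>
      (\<forall>x\<in>C. F (x, 0) \<in> \<real> \<and> 0 < Re (F (x, 0))) \<and>
      (\<exists>\<beta>>0. completely_monotone_on (\<lambda>x. Re (F (x, 0)) powr (- \<beta>)) C)"
  then show "\<forall>z\<in>tube C. F z \<noteq> 0"
    using nonzero_on_tube[of C F] by (auto simp: tube_def)
next
  assume *: "complex_analytic_on (*s) G right_half_planes \<and>
      (\<forall>x\<in>positive_orthant. G (complex_vec x) \<in> \<real> \<and> 0 < Re (G (complex_vec x))) \<and>
      (\<exists>\<beta>>0. completely_monotone_on (\<lambda>x. Re (G (complex_vec x)) powr (- \<beta>)) positive_orthant)"
  \<comment> \<open>The identification of the complexification of the real coordinate space with the
    complex one. It respects complex scaling, so \<open>G \<circ> J\<close> is analytic on the tube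
    and the first half applies to it.\<close>
  define J :: "(real ^ 'n) \<times> (real ^ 'n) \<Rightarrow> complex ^ 'n"
    where "J p = (\<chi> i. Complex (fst p $ i) (snd p $ i))" for p
  have "linear J"
    by (rule linearI) (auto simp: J_def vec_eq_iff complex_eq_iff)
  then have J: "(J has_derivative J) F" for F
    by (intro bounded_linear_imp_has_derivative) (simp add: linear_conv_bounded_linear)
  have J_scale: "J (complexification_scale a p) = a *s J p" for a p
    by (auto simp: J_def complexification_scale_def vec_eq_iff complex_eq_iff split: prod.splits)
  have J_real: "J (x, 0) = complex_vec x" for x
    by (simp add: J_def complex_vec_def vec_eq_iff complex_eq_iff)
  have "open_convex_cone (positive_orthant :: (real ^ 'n) set)"
    unfolding open_convex_cone_def
  proof (intro conjI ballI allI impI)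
    have "positive_orthant = (\<Inter>i\<in>UNIV. {x::real ^ 'n. 0 < x $ i})"
      by (auto simp: positive_orthant_def)
    moreover have "open (\<Inter>i\<in>UNIV. {x::real ^ 'n. 0 < x $ i})"
      by (intro open_INT ballI open_Collect_less continuous_intros) auto
    ultimately show "open (positive_orthant :: (real ^ 'n) set)" by simp
    show "convex (positive_orthant :: (real ^ 'n) set)"
    proof (rule convexI)
      fix x y :: "real ^ 'n" and a b :: real
      assume "x \<in> positive_orthant" "y \<in> positive_orthant" "0 \<le> a" "0 \<le> b" "a + b = 1"
      then show "a *\<^sub>R x + b *\<^sub>R y \<in> positive_orthant"
        \<comment> \<open>If \<open>a = 0\<close> then \<open>b = 1\<close> and the point is
          \<open>y\<close>; otherwise the first summand is already strictly positive in each
          coordinate.\<close>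
        by (cases "a = 0") (auto simp: positive_orthant_def less_imp_le intro!: add_pos_nonneg)
    qed
  qed (auto simp: positive_orthant_def)
  moreover have "complex_analytic_on complexification_scale (G \<circ> J) (tube positive_orthant)"
    unfolding complex_analytic_on_def
  proof
    fix p assume "p \<in> tube (positive_orthant :: (real ^ 'n) set)"
    then have "J p \<in> right_half_planes"
      by (auto simp: tube_def positive_orthant_def right_half_planes_def J_def)
    then obtain D where D: "(G has_derivative D) (at (J p))" "\<And>a h. D (a *s h) = a * D h"
      using * unfolding complex_analytic_on_def by blast
    then have "((G \<circ> J) has_derivative (D \<circ> J)) (at p)"
      using diff_chain_at[OF J] by blast
    then show "\<exists>D. ((G \<circ> J) has_derivative D) (at p) \<and>
        (\<forall>a h. D (complexification_scale a h) = a * D h)"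
      using D(2) J_scale by (intro exI[of _ "D \<circ> J"]) auto
  qed
  ultimately have nz: "(G \<circ> J) (x, y) \<noteq> 0" if "x \<in> positive_orthant" for x y
    using * that nonzero_on_tube[of positive_orthant "G \<circ> J" _ x y] by (auto simp: J_real)
  show "half_plane_property G"
    unfolding half_plane_property_def
  proof
    fix z :: "complex ^ 'n" assume "z \<in> right_half_planes"
    then have "(G \<circ> J) (\<chi> i. Re (z $ i), \<chi> i. Im (z $ i)) \<noteq> 0"
      by (intro nz) (auto simp: right_half_planes_def positive_orthant_def)
    then show "G z \<noteq> 0" by (simp add: J_def)
  qed
qed

end
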